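(* Let $\mathfrak n_{5,5}$ be the Lie algebra over $\mathbb F$ with ordered basis $\{x_1,x_2,x_3,x_4,x_5\}$ whose only nonzero brackets of basis elements (up to skew-symmetry) are $[x_5,x_2]=-x_1$, $[x_5,x_3]=-x_2$, and $[x_5,x_4]=-x_3$. Then for all $j,k,l,m,n,p,q,r,s,t\in\mathbb Z_{\ge0}$ the following identity holds in $\mathbf U(\mathfrak n_{5,5})$: $$\begin{aligned} &(x_1^jx_2^kx_3^lx_4^mx_5^n)(x_1^px_2^qx_3^rx_4^sx_5^t)\\ &=\sum_{\alpha=0}^{\min\{n,q\}}\ \sum_{\substack{\beta_1,\beta_2\in\mathbb Z_{\ge0}\\ \beta_1+\beta_2\leq r\\ \beta_1+2\beta_2\leq n-\alpha}}\ \sum_{\substack{\gamma_1,\gamma_2,\gamma_3\in\mathbb Z_{\geq0}\\ \gamma_1+\gamma_2+\gamma_3\leq s\\ \gamma_1+2\gamma_2+3\gamma_3\leq n-\alpha-\beta_1-2\beta_2}}\binom{n}{\alpha}\binom{q}{\alpha}\binom{r}{\beta_1+\beta_2}\binom{n-\alpha}{\beta_1+2\beta_2}\binom{\beta_1+\beta_2}{\beta_1}\\ &\quad\times \binom{s}{\gamma_1+\gamma_2+\gamma_3}\binom{n-\alpha-\beta_1-2\beta_2}{\gamma_1+2\gamma_2+3\gamma_3}\alpha!\,\frac{(\beta_1+2\beta_2)!}{2^{\beta_2}}\,\frac{(\gamma_1+\gamma_2+\gamma_3)!\,(\gamma_1+2\gamma_2+3\gamma_3)!}{(2!)^{\gamma_2}(3!)^{\gamma_3}\gamma_3!\,\gamma_2!\,\gamma_1!}\\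 &\quad\times (-1)^{\alpha+\beta_1+\gamma_1+\gamma_3}\,x_1^{j+p+\alpha+\beta_2+\gamma_3}x_2^{k+q-\alpha+\beta_1+\gamma_2}x_3^{l+r-\beta_1-\beta_2+\gamma_1}x_4^{m+s-\gamma_1-\gamma_2-\gamma_3}x_5^{n+t-\alpha-\beta_1-2\beta_2-\gamma_1-2\gamma_2-3\gamma_3}. \end{aligned}$$
   Context: $\mathbb F$ is $\mathbb R$ or $\mathbb C$. $\mathbf U(L)$ denotes the universal enveloping algebra of the Lie algebra $L$ (the universal unital associative $\mathbb F$-algebra with a linear map $\iota:L\to\mathbf U(L)$ satisfying $\iota([x,y])=\iota(x)\iota(y)-\iota(y)\iota(x)$). Elements of $L$ are identified with their images under $\iota$, so $xy=yx+[x,y]$ in $\mathbf U(L)$ for $x,y\in L$; powers and products of the $x_i$ are taken in $\mathbf U(L)$. *)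

theory Defs
  imports
    "HOL-Library.Poly_Mapping"
    "HOL-Library.Product_Plus"
    "HOL-Algebra.QuotRing"
    "HOL-Algebra.Module"
    "HOL-Algebra.Algebraic_Closure_Type"
begin

section \<open>Lie algebras\<close>

locale lie_algebra = vector_space scale
  for scale :: "'f::field \<Rightarrow> 'l::ab_group_add \<Rightarrow> 'l" +
  fixes bracket :: "'l \<Rightarrow> 'l \<Rightarrow> 'l"
  assumes bracket_add_left: "bracket (x + y) z = bracket x z + bracket y z"
    and bracket_add_right: "bracket x (y + z) = bracket x y + bracket x z"
    and bracket_scale_left: "bracket (scale c x) y = scale c (bracket x y)"
    and bracket_scale_right: "bracket x (scale c y) = scale c (bracket x y)"
    and bracket_self: "bracket x x = 0"
    and jacobi: "bracket x (bracket y z) + bracket y (bracket z x) + bracket z (bracket x y) = 0"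

text \<open>
  The Lie algebra with ordered basis \<open>x 1, \<dots>, x 5\<close>; only the values of \<open>x\<close> on \<open>{1..5}\<close> matter.
\<close>

locale lie_n55 = lie_algebra scale bracket
  for scale :: "'f::field \<Rightarrow> 'l::ab_group_add \<Rightarrow> 'l" and bracket :: "'l \<Rightarrow> 'l \<Rightarrow> 'l" +
  fixes x :: "nat \<Rightarrow> 'l"
  assumes basis_inj: "inj_on x {1..5}"
    and basis_independent: "independent (x ` {1..5})"
    and basis_span: "span (x ` {1..5}) = UNIV"
    and bracket_5_2: "bracket (x 5) (x 2) = - x 1"
    and bracket_5_3: "bracket (x 5) (x 3) = - x 2"
    and bracket_5_4: "bracket (x 5) (x 4) = - x 3"
    and bracket_other: "\<And>i j. i \<in> {1..5} \<Longrightarrow> j \<in> {1..5} \<Longrightarrow>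
          {i, j} \<notin> {{5, 2}, {5, 3}, {5, 4}} \<Longrightarrow> bracket (x i) (x j) = 0"

text \<open>The locale is inhabited: coordinates with respect to the basis give a model over any field.\<close>

lemma lie_n55_model:
  fixes scale :: "'f::field \<Rightarrow> 'f \<times> 'f \<times> 'f \<times> 'f \<times> 'f \<Rightarrow> 'f \<times> 'f \<times> 'f \<times> 'f \<times> 'f"
  assumes scale: "\<And>c a1 a2 a3 a4 a5. scale c (a1, a2, a3, a4, a5) = (c*a1, c*a2, c*a3, c*a4, c*a5)"
    and bracket: "\<And>a1 a2 a3 a4 a5 b1 b2 b3 b4 b5. bracket (a1, a2, a3, a4, a5) (b1, b2, b3, b4, b5) =
      (a2*b5 - a5*b2, a3*b5 - a5*b3, a4*b5 - a5*b4, 0, 0)"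
    and x: "x = (\<lambda>i::nat. (of_bool (i = 1), of_bool (i = 2), of_bool (i = 3), of_bool (i = 4), of_bool (i = 5)))"
  shows "lie_n55 scale bracket x"
proof -
  interpret lie_algebra scale bracket
    by unfold_locales (auto simp: scale bracket zero_prod_def algebra_simps)
  have I: "{1..5} = {1, 2, 3, 4, 5::nat}" by auto
  have inj: "inj_on x {1..5}" unfolding I x by simp
  have comb: "(\<Sum>i\<in>{1..5}. scale (c i) (x i)) = (c 1, c 2, c 3, c 4, c 5)" for c
    unfolding I x by (simp add: scale)
  show ?thesis
  proof
    show "inj_on x {1..5}" by (rule inj)
    show "independent (x ` {1..5})"
    proof (rule independent_if_scalars_zero)
      fix f v assume f: "(\<Sum>v\<in>x ` {1..5}. scale (f v) v) = 0" and v: "v \<in> x ` {1..5}"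
      have "(\<Sum>i\<in>{1..5}. scale (f (x i)) (x i)) = 0"
        using f by (simp only: sum.reindex[OF inj] o_def)
      then have "f (x 1) = 0 \<and> f (x 2) = 0 \<and> f (x 3) = 0 \<and> f (x 4) = 0 \<and> f (x 5) = 0"
        unfolding comb by (simp add: zero_prod_def)
      then show "f v = 0" using v unfolding I by blast
    qed simp
    have "v \<in> span (x ` {1..5})" for v
    proof -
      obtain a1 a2 a3 a4 a5 where v: "v = (a1, a2, a3, a4, a5)" by (cases v)
      have "v = (\<Sum>i\<in>{1..5}. scale ([0, a1, a2, a3, a4, a5] ! i) (x i))"
        unfolding comb v by (simp add: numeral_eq_Suc)
      also have "\<dots> \<in> span (x ` {1..5})"
        by (intro span_sum span_scale span_base imageI)
      finally show ?thesis .
    qed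
    then show "span (x ` {1..5}) = UNIV" by blast
    show "bracket (x i) (x j) = 0" if "i \<in> {1..5}" "j \<in> {1..5}"
      "{i, j} \<notin> {{5, 2}, {5, 3}, {5, 4}}" for i j
      using that by (auto simp: x bracket zero_prod_def doubleton_eq_iff)
  qed (simp_all add: x bracket)
qed

section \<open>The universal enveloping algebra\<close>

text \<open>
  Words over a set form a monoid under concatenation. Written additively, this makes
  \<^typ>\<open>'l list \<Rightarrow>\<^sub>0 'f\<close>, with its convolution product from the library, the free unital associative
  algebra on the set \<^typ>\<open>'l\<close> with coefficients in \<^typ>\<open>'f\<close>.
\<close>

instantiation list :: (type) monoid_add
begin

definition zero_list :: "'a list" where "0 = []"

definition plus_list :: "'a list \<Rightarrow> 'a list \<Rightarrow> 'a list" where "xs + ys = xs @ ys"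

instance
  by standard (simp_all add: zero_list_def plus_list_def)

end

abbreviation free_alg :: "('l list \<Rightarrow>\<^sub>0 'f::field) ring" where
  "free_alg \<equiv> ring_of_type_algebra"

definition free_gen :: "'l \<Rightarrow> ('l list \<Rightarrow>\<^sub>0 'f::field)" where
  "free_gen a = Poly_Mapping.single [a] 1"

definition free_scalar :: "'f::field \<Rightarrow> ('l list \<Rightarrow>\<^sub>0 'f)" where
  "free_scalar c = Poly_Mapping.single [] c"

text \<open>
  The generators are all elements of the Lie algebra, so besides the bracket relation we impose
  linearity of the map sending an element to the generator it names.
\<close>

definition uea_relations ::
    "('f::field \<Rightarrow> 'l::ab_group_add \<Rightarrow> 'l) \<Rightarrow> ('l \<Rightarrow> 'l \<Rightarrow> 'l) \<Rightarrow> ('l list \<Rightarrow>\<^sub>0 'f) set" where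
  "uea_relations scale bracket =
     {free_gen (a + b) - (free_gen a + free_gen b) |a b. True} \<union>
     {free_gen (scale c a) - free_scalar c * free_gen a |c a. True} \<union>
     {free_gen (bracket a b) - (free_gen a * free_gen b - free_gen b * free_gen a) |a b. True}"

definition uea_ideal ::
    "('f::field \<Rightarrow> 'l::ab_group_add \<Rightarrow> 'l) \<Rightarrow> ('l \<Rightarrow> 'l \<Rightarrow> 'l) \<Rightarrow> ('l list \<Rightarrow>\<^sub>0 'f) set" where
  "uea_ideal scale bracket = genideal free_alg (uea_relations scale bracket)"

definition uea ::
    "('f::field \<Rightarrow> 'l::ab_group_add \<Rightarrow> 'l) \<Rightarrow> ('l \<Rightarrow> 'l \<Rightarrow> 'l) \<Rightarrow> ('f, ('l list \<Rightarrow>\<^sub>0 'f) set) module" where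
  "uea scale bracket =
     (let I = uea_ideal scale bracket; Q = free_alg Quot I in
      ring.extend Q
        (module.fields (\<lambda>c A. (I +>\<^bsub>free_alg\<^esub> free_scalar c) \<otimes>\<^bsub>Q\<^esub> A)))"

definition uea_incl ::
    "('f::field \<Rightarrow> 'l::ab_group_add \<Rightarrow> 'l) \<Rightarrow> ('l \<Rightarrow> 'l \<Rightarrow> 'l) \<Rightarrow> 'l \<Rightarrow> ('l list \<Rightarrow>\<^sub>0 'f) set" where
  "uea_incl scale bracket a = uea_ideal scale bracket +>\<^bsub>free_alg\<^esub> free_gen a"


subsection \<open>Basic facts\<close>

lemma ring_of_type_algebra_sel [simp]:
  "carrier (ring_of_type_algebra :: 'b::ring_1 ring) = UNIV"
  "(a::'b) \<otimes>\<^bsub>ring_of_type_algebra\<^esub> b = a * b"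
  "(a::'b) \<oplus>\<^bsub>ring_of_type_algebra\<^esub> b = a + b"
  "\<one>\<^bsub>ring_of_type_algebra\<^esub> = (1::'b)"
  "\<zero>\<^bsub>ring_of_type_algebra\<^esub> = (0::'b)"
  by (simp_all add: ring_of_type_algebra_def)

lemma ring_of_type_algebra_ring: "ring (ring_of_type_algebra :: 'b::ring_1 ring)"
proof -
  have "\<exists>y. x + y = 0" for x :: 'b
    using add.right_inverse by blast
  then show ?thesis
    unfolding ring_of_type_algebra_def using add.right_inverse
    by unfold_locales (auto simp: algebra_simps Units_def)
qed

lemma ring_of_type_algebra_minus [simp]:
  "(a::'b::ring_1) \<ominus>\<^bsub>ring_of_type_algebra\<^esub> b = a - b"
proof -
  interpret R: ring "ring_of_type_algebra :: 'b ring" by (rule ring_of_type_algebra_ring)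
  have "\<ominus>\<^bsub>ring_of_type_algebra\<^esub> b = - b"
    by (rule R.minus_equality) auto
  then show ?thesis by (simp add: a_minus_def)
qed

lemma uea_ideal_ideal: "ideal (uea_ideal scale bracket) free_alg"
  unfolding uea_ideal_def
  by (rule ring.genideal_ideal[OF ring_of_type_algebra_ring]) simp

lemma uea_sel:
  "carrier (uea scale bracket) = carrier (free_alg Quot uea_ideal scale bracket)"
  "monoid.mult (uea scale bracket) = monoid.mult (free_alg Quot uea_ideal scale bracket)"
  "monoid.one (uea scale bracket) = monoid.one (free_alg Quot uea_ideal scale bracket)"
  "ring.zero (uea scale bracket) = ring.zero (free_alg Quot uea_ideal scale bracket)"
  "ring.add (uea scale bracket) = ring.add (free_alg Quot uea_ideal scale bracket)"
  "Module.smult (uea scale bracket) =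
     (\<lambda>c A. (uea_ideal scale bracket +>\<^bsub>free_alg\<^esub> free_scalar c)
        \<otimes>\<^bsub>free_alg Quot uea_ideal scale bracket\<^esub> A)"
  by (simp_all add: uea_def Let_def ring.extend_def module.fields_def)

context
  fixes scale :: "'f::field \<Rightarrow> 'l::ab_group_add \<Rightarrow> 'l" and bracket :: "'l \<Rightarrow> 'l \<Rightarrow> 'l"
begin

abbreviation uea_proj :: "('l list \<Rightarrow>\<^sub>0 'f) \<Rightarrow> ('l list \<Rightarrow>\<^sub>0 'f) set" where
  "uea_proj p \<equiv> uea_ideal scale bracket +>\<^bsub>free_alg\<^esub> p"

lemma uea_ring: "ring (uea scale bracket)"
proof -
  interpret Q: ring "free_alg Quot uea_ideal scale bracket"
    by (rule ideal.quotient_is_ring[OF uea_ideal_ideal])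
  have inv: "\<exists>y\<in>carrier (uea scale bracket). x \<oplus>\<^bsub>uea scale bracket\<^esub> y = \<zero>\<^bsub>uea scale bracket\<^esub>
      \<and> y \<oplus>\<^bsub>uea scale bracket\<^esub> x = \<zero>\<^bsub>uea scale bracket\<^esub>"
    if "x \<in> carrier (uea scale bracket)" for x
    using that Q.a_inv_closed Q.r_neg Q.l_neg unfolding uea_sel by blast
  show ?thesis
  proof (rule ringI)
    show "abelian_group (uea scale bracket)"
    proof (rule abelian_groupI)
      fix x assume "x \<in> carrier (uea scale bracket)"
      then show "\<exists>y\<in>carrier (uea scale bracket). y \<oplus>\<^bsub>uea scale bracket\<^esub> x = \<zero>\<^bsub>uea scale bracket\<^esub>"
        using inv by blast
    qed (auto simp: uea_sel Q.a_ac)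
    show "monoid (uea scale bracket)"
      by (rule monoidI) (auto simp: uea_sel Q.m_assoc)
  qed (auto simp: uea_sel Q.l_distr Q.r_distr)
qed

lemma uea_carrier: "carrier (uea scale bracket) = range uea_proj"
  by (auto simp: uea_sel FactRing_def A_RCOSETS_def')

lemma uea_proj_hom:
  "uea_proj p \<oplus>\<^bsub>uea scale bracket\<^esub> uea_proj q = uea_proj (p + q)"
  "uea_proj p \<otimes>\<^bsub>uea scale bracket\<^esub> uea_proj q = uea_proj (p * q)"
  "\<one>\<^bsub>uea scale bracket\<^esub> = uea_proj 1"
  "c \<odot>\<^bsub>uea scale bracket\<^esub> uea_proj p = uea_proj (free_scalar c * p)"
  using ideal.rcos_ring_hom[OF uea_ideal_ideal, of scale bracket]
  by (auto simp: uea_sel ring_hom_def)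

lemma uea_proj_eq_iff: "uea_proj p = uea_proj q \<longleftrightarrow> p - q \<in> uea_ideal scale bracket"
  using ring.quotient_eq_iff_same_a_r_cos[OF ring_of_type_algebra_ring uea_ideal_ideal, of p q]
  by simp

lemma uea_relations_ideal: "p \<in> uea_relations scale bracket \<Longrightarrow> p \<in> uea_ideal scale bracket"
  using ring.genideal_self[OF ring_of_type_algebra_ring] unfolding uea_ideal_def by fastforce

lemma uea_incl_closed: "uea_incl scale bracket a \<in> carrier (uea scale bracket)"
  by (simp add: uea_incl_def uea_carrier)

lemma uea_incl_add:
  "uea_incl scale bracket (a + b) =
     uea_incl scale bracket a \<oplus>\<^bsub>uea scale bracket\<^esub> uea_incl scale bracket b"
  unfolding uea_incl_def uea_proj_hom uea_proj_eq_iff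
  by (rule uea_relations_ideal) (auto simp: uea_relations_def)

lemma uea_incl_scale:
  "uea_incl scale bracket (scale c a) = c \<odot>\<^bsub>uea scale bracket\<^esub> uea_incl scale bracket a"
  unfolding uea_incl_def uea_proj_hom uea_proj_eq_iff
  by (rule uea_relations_ideal) (auto simp: uea_relations_def)

lemma uea_incl_bracket:
  "uea_incl scale bracket (bracket a b) =
     uea_incl scale bracket a \<otimes>\<^bsub>uea scale bracket\<^esub> uea_incl scale bracket b
     \<ominus>\<^bsub>uea scale bracket\<^esub> uea_incl scale bracket b \<otimes>\<^bsub>uea scale bracket\<^esub> uea_incl scale bracket a"
proof -
  interpret U: ring "uea scale bracket" by (rule uea_ring)
  have "uea_incl scale bracket (bracket a b) \<oplus>\<^bsub>uea scale bracket\<^esub>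
      uea_incl scale bracket b \<otimes>\<^bsub>uea scale bracket\<^esub> uea_incl scale bracket a
      = uea_incl scale bracket a \<otimes>\<^bsub>uea scale bracket\<^esub> uea_incl scale bracket b"
    unfolding uea_incl_def uea_proj_hom uea_proj_eq_iff
  proof (rule uea_relations_ideal)
    have "free_gen (bracket a b) - (free_gen a * free_gen b - free_gen b * free_gen a)
        \<in> uea_relations scale bracket"
      unfolding uea_relations_def by blast
    then show "free_gen (bracket a b) + free_gen b * free_gen a - free_gen a * free_gen b
        \<in> uea_relations scale bracket"
      by (simp add: algebra_simps)
  qed
  then show ?thesis
    by (metis U.add.inv_solve_right U.m_closed a_minus_def uea_incl_closed)
qed

end

subsection \<open>The universal property\<close>

lemma poly_mapping_additive_induct [case_names single add]:
  fixes p :: "'a \<Rightarrow>\<^sub>0 'b::comm_monoid_add"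
  assumes single: "\<And>k v. P (Poly_Mapping.single k v)"
    and add: "\<And>p q. P p \<Longrightarrow> P q \<Longrightarrow> P (p + q)"
  shows "P p"
proof (induction p rule: Poly_Mapping.update_induct)
  case const
  then show ?case using single[of undefined 0] by simp
next
  case (update f a b)
  have "Poly_Mapping.update a b f = Poly_Mapping.single a b + f"
    using update(1)
    by (intro poly_mapping_eqI)
       (auto simp: lookup_update lookup_add lookup_single in_keys_iff)
  then show ?case using single add update by metis
qed

definition free_lift :: "('f::field \<Rightarrow> 'b::ring_1 \<Rightarrow> 'b) \<Rightarrow> ('l \<Rightarrow> 'b) \<Rightarrow> ('l list \<Rightarrow>\<^sub>0 'f) \<Rightarrow> 'b" where
  "free_lift s \<phi> p =
     (\<Sum>w\<in>Poly_Mapping.keys p. s (Poly_Mapping.lookup p w) (prod_list (List.map \<phi> w)))"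

locale assoc_algebra = vector_space s
  for s :: "'f::field \<Rightarrow> 'b::ring_1 \<Rightarrow> 'b" +
  assumes s_mult_left: "s c a * b = s c (a * b)"
    and s_mult_right: "a * s c b = s c (a * b)"
begin

lemma free_lift_superset:
  assumes "finite W" "Poly_Mapping.keys p \<subseteq> W"
  shows "free_lift s \<phi> p = (\<Sum>w\<in>W. s (Poly_Mapping.lookup p w) (prod_list (List.map \<phi> w)))"
  unfolding free_lift_def using assms
  by (intro sum.mono_neutral_left) (auto simp: in_keys_iff)

lemma free_lift_add: "free_lift s \<phi> (p + q) = free_lift s \<phi> p + free_lift s \<phi> q"
proof -
  let ?W = "Poly_Mapping.keys p \<union> Poly_Mapping.keys q"
  have "free_lift s \<phi> (p + q) = (\<Sum>w\<in>?W. s (Poly_Mapping.lookup (p + q) w) (prod_list (List.map \<phi> w)))"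
    by (rule free_lift_superset) (use Poly_Mapping.keys_add[of p q] in auto)
  also have "\<dots> = free_lift s \<phi> p + free_lift s \<phi> q"
    by (simp add: free_lift_superset[of ?W p] free_lift_superset[of ?W q]
        lookup_add scale_left_distrib sum.distrib)
  finally show ?thesis .
qed

lemma free_lift_single: "free_lift s \<phi> (Poly_Mapping.single w c) = s c (prod_list (List.map \<phi> w))"
  by (cases "c = 0") (auto simp: free_lift_def)

lemma free_lift_mult: "free_lift s \<phi> (p * q) = free_lift s \<phi> p * free_lift s \<phi> q"
proof (induction p rule: poly_mapping_additive_induct)
  case (single w c)
  show ?case
  proof (induction q rule: poly_mapping_additive_induct)
    case (single v d)
    then show ?case
      by (simp add: mult_single free_lift_single plus_list_def s_mult_left s_mult_right)
  qed (simp add: distrib_left free_lift_add)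
qed (simp add: distrib_right free_lift_add)

lemma free_lift_one: "free_lift s \<phi> 1 = 1"
  using free_lift_single[of \<phi> 0 1] by (simp only: single_one) (simp add: zero_list_def)

lemma free_lift_gen: "free_lift s \<phi> (free_gen a) = \<phi> a"
  by (simp add: free_gen_def free_lift_single)

lemma free_lift_scalar: "free_lift s \<phi> (free_scalar c) = s c 1"
  by (simp add: free_scalar_def free_lift_single)

lemma free_lift_diff: "free_lift s \<phi> (p - q) = free_lift s \<phi> p - free_lift s \<phi> q"
  using free_lift_add[of \<phi> "p - q" q] by simp

theorem uea_universal:
  fixes scale :: "'f \<Rightarrow> 'l::ab_group_add \<Rightarrow> 'l" and bracket :: "'l \<Rightarrow> 'l \<Rightarrow> 'l" and \<phi> :: "'l \<Rightarrow> 'b"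
  assumes \<phi>_add: "\<And>a b. \<phi> (a + b) = \<phi> a + \<phi> b"
    and \<phi>_scale: "\<And>c a. \<phi> (scale c a) = s c (\<phi> a)"
    and \<phi>_bracket: "\<And>a b. \<phi> (bracket a b) = \<phi> a * \<phi> b - \<phi> b * \<phi> a"
  shows "\<exists>!\<Phi>. \<Phi> \<in> ring_hom (uea scale bracket) ring_of_type_algebra \<inter> extensional (carrier (uea scale bracket))
    \<and> (\<forall>c. \<forall>A\<in>carrier (uea scale bracket). \<Phi> (c \<odot>\<^bsub>uea scale bracket\<^esub> A) = s c (\<Phi> A))
    \<and> (\<forall>a. \<Phi> (uea_incl scale bracket a) = \<phi> a)"
proof (rule ex_ex1I)
  let ?I = "uea_ideal scale bracket" and ?U = "uea scale bracket"
  let ?L = "free_lift s \<phi>" and ?pr = "uea_proj scale bracket"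
  have L0: "?L 0 = 0" by (simp add: free_lift_def)
  interpret F: ring "free_alg :: ('l list \<Rightarrow>\<^sub>0 'f) ring" by (rule ring_of_type_algebra_ring)
  have "ring_hom_ring free_alg (ring_of_type_algebra :: 'b ring) ?L"
    by (intro ring_hom_ringI ring_of_type_algebra_ring)
       (auto simp: free_lift_mult free_lift_add free_lift_one)
  then have "ideal (a_kernel free_alg (ring_of_type_algebra :: 'b ring) ?L) free_alg"
    by (rule ring_hom_ring.kernel_is_ideal)
  moreover have "uea_relations scale bracket \<subseteq> a_kernel free_alg (ring_of_type_algebra :: 'b ring) ?L"
    by (auto simp: a_kernel_def' uea_relations_def free_lift_diff free_lift_add free_lift_mult
        free_lift_gen free_lift_scalar \<phi>_add \<phi>_scale \<phi>_bracket s_mult_left)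
  ultimately have "?I \<subseteq> a_kernel free_alg (ring_of_type_algebra :: 'b ring) ?L"
    unfolding uea_ideal_def by (rule F.genideal_minimal)
  then have kill: "?L p = 0" if "p \<in> ?I" for p
    using that by (auto simp: a_kernel_def')
  define \<Phi> where "\<Phi> = restrict (\<lambda>A. ?L (SOME p. A = ?pr p)) (carrier ?U)"
  have \<Phi>_pr: "\<Phi> (?pr p) = ?L p" for p
  proof -
    define p' where "p' = (SOME p'. ?pr p = ?pr p')"
    have "?pr p = ?pr p'" unfolding p'_def by (rule someI[of _ p]) simp
    then have "?L (p - p') = 0" by (intro kill) (simp add: uea_proj_eq_iff)
    then have "?L p' = ?L p" by (simp add: free_lift_diff)
    then show ?thesis by (simp add: \<Phi>_def uea_carrier p'_def)
  qed
  show "\<exists>\<Phi>. \<Phi> \<in> ring_hom ?U ring_of_type_algebra \<inter> extensional (carrier ?U)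
    \<and> (\<forall>c. \<forall>A\<in>carrier ?U. \<Phi> (c \<odot>\<^bsub>?U\<^esub> A) = s c (\<Phi> A)) \<and> (\<forall>a. \<Phi> (uea_incl scale bracket a) = \<phi> a)"
  proof (intro exI[of _ \<Phi>] conjI IntI allI ballI)
    show "\<Phi> \<in> ring_hom ?U ring_of_type_algebra"
      by (rule ring_hom_memI)
         (auto simp: uea_carrier uea_proj_hom \<Phi>_pr free_lift_mult free_lift_add free_lift_one)
    show "\<Phi> \<in> extensional (carrier ?U)" by (simp add: \<Phi>_def)
    show "\<Phi> (c \<odot>\<^bsub>?U\<^esub> A) = s c (\<Phi> A)" if "A \<in> carrier ?U" for c A
      using that
      by (auto simp: uea_carrier uea_proj_hom \<Phi>_pr free_lift_mult free_lift_scalar s_mult_left)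
    show "\<Phi> (uea_incl scale bracket a) = \<phi> a" for a
      by (simp add: uea_incl_def \<Phi>_pr free_lift_gen)
  qed
next
  let ?U = "uea scale bracket" and ?pr = "uea_proj scale bracket"
  fix \<Phi> \<Psi> :: "('l list \<Rightarrow>\<^sub>0 'f) set \<Rightarrow> 'b"
  assume \<Phi>: "\<Phi> \<in> ring_hom ?U ring_of_type_algebra \<inter> extensional (carrier ?U)
    \<and> (\<forall>c. \<forall>A\<in>carrier ?U. \<Phi> (c \<odot>\<^bsub>?U\<^esub> A) = s c (\<Phi> A)) \<and> (\<forall>a. \<Phi> (uea_incl scale bracket a) = \<phi> a)"
  assume \<Psi>: "\<Psi> \<in> ring_hom ?U ring_of_type_algebra \<inter> extensional (carrier ?U)
    \<and> (\<forall>c. \<forall>A\<in>carrier ?U. \<Psi> (c \<odot>\<^bsub>?U\<^esub> A) = s c (\<Psi> A)) \<and> (\<forall>a. \<Psi> (uea_incl scale bracket a) = \<phi> a)"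
  have lift: "\<Theta> (?pr p) = free_lift s \<phi> p"
    if \<Theta>: "\<Theta> \<in> ring_hom ?U (ring_of_type_algebra :: 'b ring)"
      and sc: "\<And>c A. A \<in> carrier ?U \<Longrightarrow> \<Theta> (c \<odot>\<^bsub>?U\<^esub> A) = s c (\<Theta> A)"
      and incl: "\<And>a. \<Theta> (uea_incl scale bracket a) = \<phi> a" for \<Theta> p
  proof (induction p rule: poly_mapping_additive_induct)
    case (add p q)
    then show ?case
      using ring_hom_add[OF \<Theta>, of "?pr p" "?pr q"] by (simp add: uea_proj_hom uea_carrier free_lift_add)
  next
    case (single w c)
    have w: "\<Theta> (?pr (Poly_Mapping.single w 1)) = prod_list (List.map \<phi> w)"
    proof (induction w)
      case Nil
      then show ?case
        using ring_hom_one[OF \<Theta>] by (simp add: uea_proj_hom zero_list_def flip: single_one)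
    next
      case (Cons a w)
      have "Poly_Mapping.single (a # w) 1 = free_gen a * Poly_Mapping.single w (1::'f)"
        by (simp add: free_gen_def mult_single plus_list_def)
      then have "\<Theta> (?pr (Poly_Mapping.single (a # w) 1)) = \<Theta> (?pr (free_gen a)) * \<Theta> (?pr (Poly_Mapping.single w 1))"
        using ring_hom_mult[OF \<Theta>, of "?pr (free_gen a)" "?pr (Poly_Mapping.single w 1)"]
        by (simp add: uea_proj_hom uea_carrier)
      then show ?case using Cons incl[of a] by (simp add: uea_incl_def)
    qed
    have "Poly_Mapping.single w c = free_scalar c * Poly_Mapping.single w 1"
      by (simp add: free_scalar_def mult_single plus_list_def)
    then have "?pr (Poly_Mapping.single w c) = c \<odot>\<^bsub>?U\<^esub> ?pr (Poly_Mapping.single w 1)"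
      by (simp add: uea_proj_hom)
    then show ?case
      using sc[of "?pr (Poly_Mapping.single w 1)" c] w by (simp add: uea_carrier free_lift_single)
  qed
  have "\<Phi> A = \<Psi> A" if "A \<in> carrier ?U" for A
    using that lift[of \<Phi>] lift[of \<Psi>] \<Phi> \<Psi> unfolding uea_carrier by auto
  then show "\<Phi> = \<Psi>"
    using \<Phi> \<Psi> by (intro extensionalityI[of _ "carrier ?U"]) auto
qed

end

end

theory Submission
  imports Defs
begin

text \<open>
  Write \<open>y = x\<^sub>5\<close> and \<open>(n)\<^sub>i = n(n - 1)\<cdots>(n - i + 1)\<close>. The elements \<open>x\<^sub>1, \<dots>, x\<^sub>4\<close> commute, and \<open>ad y\<close> acts on
  them as a nilpotent shift \<open>x\<^sub>k \<mapsto> - x\<^bsub>k-1\<^esub>\<close>, \<open>x\<^sub>1 \<mapsto> 0\<close>. The Leibniz rule therefore reads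
  \<open>y\<^sup>n x\<^sub>k = \<Sum>\<^sub>j (n)\<^sub>j (-1)\<^sup>j/j! x\<^bsub>k-j\<^esub> y\<^bsup>n-j\<^esup>\<close>. Up to the factor \<open>(n)\<^sub>j\<close>, these are the
  coefficients of the polynomial \<open>exp(t ad y) x\<^sub>k = \<Sum>\<^sub>j (-t)\<^sup>j/j! x\<^bsub>k-j\<^esub>\<close>.

  To use this, work in the commutative polynomial ring in \<open>x\<^sub>1, \<dots>, x\<^sub>4, t\<close> and let \<open>N\<^sub>n\<close> be the linear map
  into the noncommutative algebra that sends \<open>x\<^sup>v t\<^sup>i\<close> to \<open>(n)\<^sub>i x\<^sup>v y\<^bsup>n-i\<^esup>\<close>. Because
  \<open>(n)\<^sub>i (n - i)\<^sub>j = (n)\<^bsub>i+j\<^esub>\<close>, the Leibniz rule says that multiplying \<open>N\<^sub>n(f)\<close> by \<open>x\<^sub>k\<close> on the right is the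
  same as multiplying \<open>f\<close> by \<open>exp(t ad y) x\<^sub>k\<close>: this is \<open>normal_order_mult_g\<close>, the heart of the proof.
  Starting from \<open>x\<^sup>v y\<^sup>n = N\<^sub>n(x\<^sup>v)\<close>, it follows that
  \<open>x\<^sup>v y\<^sup>n x\<^sub>1\<^sup>p x\<^sub>2\<^sup>q x\<^sub>3\<^sup>r x\<^sub>4\<^sup>s\<close> is the image under \<open>N\<^sub>n\<close> of
  \<open>x\<^sup>v x\<^sub>1\<^sup>p (x\<^sub>2 - t x\<^sub>1)\<^sup>q (x\<^sub>3 - t x\<^sub>2 + t\<^sup>2/2 x\<^sub>1)\<^sup>r (x\<^sub>4 - t x\<^sub>3 + t\<^sup>2/2 x\<^sub>2 - t\<^sup>3/6 x\<^sub>1)\<^sup>s\<close>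
  (\<open>ordered_monom_product\<close>). The three powers expand by the binomial, trinomial and quadrinomial
  theorems, with summation indices \<open>\<alpha>\<close>, \<open>(\<beta>\<^sub>1, \<beta>\<^sub>2)\<close> and \<open>(\<gamma>\<^sub>1, \<gamma>\<^sub>2, \<gamma>\<^sub>3)\<close>. The powers of \<open>t\<close> in the three
  factors are \<open>\<alpha>\<close>, \<open>\<beta>\<^sub>1 + 2\<beta>\<^sub>2\<close> and \<open>\<gamma>\<^sub>1 + 2\<gamma>\<^sub>2 + 3\<gamma>\<^sub>3\<close>; splitting the falling factorial of their sum
  accordingly gives the binomials in \<open>n\<close>, and its vanishing beyond \<open>n\<close> gives the bounds on the indices.

  All identities are proved between elements of the free algebra, modulo the congruence of having the
  same image in the enveloping algebra.
\<close>

section \<open>Falling factorials and multinomial expansions\<close>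

definition falling :: "nat \<Rightarrow> nat \<Rightarrow> 'f::field_char_0" where
  "falling n i = of_nat (n choose i) * fact i"

lemma falling_0 [simp]: "falling n 0 = 1"
  by (simp add: falling_def)

lemma falling_eq_0: "n < i \<Longrightarrow> falling n i = 0"
  by (simp add: falling_def)

lemma falling_add: "falling n (i + j) = falling n i * falling (n - i) j"
proof (cases "i + j \<le> n")
  case True
  then show ?thesis
    by (simp add: falling_def binomial_fact diff_diff_left)
next
  case False
  then have "n < i + j" "n < i \<or> n - i < j" by linarith+
  then show ?thesis by (auto simp: falling_def binomial_eq_0)
qed

lemma trinomial:
  fixes a b c :: "'a::comm_semiring_1"
  shows "(a + b + c) ^ r =
    (\<Sum>(i, k)\<in>{(i, k). i + k \<le> r}. of_nat ((r choose (i + k)) * ((i + k) choose i)) * (a ^ (r - i - k) * b ^ i * c ^ k))"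
proof -
  have "(a + b + c) ^ r = (b + c + a) ^ r"
    by (simp add: ac_simps)
  also have "\<dots> = (\<Sum>h\<le>r. \<Sum>i\<le>h. of_nat (r choose h) * of_nat (h choose i) * (b ^ i * c ^ (h - i) * a ^ (r - h)))"
    by (subst binomial_ring, subst binomial_ring) (simp add: sum_distrib_left sum_distrib_right mult_ac)
  also have "\<dots> = (\<Sum>(h, i)\<in>Sigma {..r} (\<lambda>h. {..h}).
      of_nat (r choose h) * of_nat (h choose i) * (b ^ i * c ^ (h - i) * a ^ (r - h)))"
    by (rule sum.Sigma) auto
  also have "\<dots> = (\<Sum>(i, k)\<in>{(i, k). i + k \<le> r}.
      of_nat ((r choose (i + k)) * ((i + k) choose i)) * (a ^ (r - i - k) * b ^ i * c ^ k))"
    by (rule sum.reindex_bij_witness[of _ "\<lambda>(i, k). (i + k, i)" "\<lambda>(h, i). (i, h - i)"])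
       (auto simp: mult_ac diff_diff_left)
  finally show ?thesis .
qed

lemma quadrinomial:
  fixes a b c d :: "'a::comm_semiring_1"
  shows "(a + b + c + d) ^ s =
    (\<Sum>(i, k, l)\<in>{(i, k, l). i + k + l \<le> s}.
       of_nat ((s choose (i + k + l)) * ((i + k + l) choose i) * ((k + l) choose k))
       * (a ^ (s - i - k - l) * b ^ i * c ^ k * d ^ l))"
proof -
  have "(a + b + c + d) ^ s = (a + b + (c + d)) ^ s"
    by (simp add: ac_simps)
  also have "\<dots> = (\<Sum>(i, h)\<in>{(i, h). i + h \<le> s}. \<Sum>k\<le>h.
      of_nat ((s choose (i + h)) * ((i + h) choose i)) * (a ^ (s - i - h) * b ^ i * (of_nat (h choose k) * c ^ k * d ^ (h - k))))"
    by (subst trinomial, subst binomial_ring) (simp add: sum_distrib_left)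
  also have "\<dots> = (\<Sum>((i, h), k)\<in>Sigma {(i, h). i + h \<le> s} (\<lambda>(i, h). {..h}).
      of_nat ((s choose (i + h)) * ((i + h) choose i)) * (a ^ (s - i - h) * b ^ i * (of_nat (h choose k) * c ^ k * d ^ (h - k))))"
  proof -
    have "finite {(i, h). i + h \<le> s}"
      by (rule finite_subset[of _ "{..s} \<times> {..s}"]) auto
    then show ?thesis
      by (subst sum.Sigma[symmetric]) (auto intro!: sum.cong)
  qed
  also have "\<dots> = (\<Sum>(i, k, l)\<in>{(i, k, l). i + k + l \<le> s}.
       of_nat ((s choose (i + k + l)) * ((i + k + l) choose i) * ((k + l) choose k))
       * (a ^ (s - i - k - l) * b ^ i * c ^ k * d ^ l))"
    by (rule sum.reindex_bij_witness[of _ "\<lambda>(i, k, l). ((i, k + l), k)" "\<lambda>((i, h), k). (i, k, h - k)"])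
       (auto simp: mult_ac diff_diff_left add.assoc)
  finally show ?thesis .
qed

text \<open>
  Converts the product of binomials from \<open>quadrinomial\<close> into the symmetric multinomial form.
\<close>

lemma multinomial_coeff:
  "of_nat ((i + k + l) choose i) * of_nat ((k + l) choose k) =
     (fact (i + k + l) / (fact l * fact k * fact i) :: 'f::field_char_0)"
  by (simp add: binomial_fact add.assoc)

lemma sum_product3:
  fixes f g h :: "_ \<Rightarrow> 'a::semiring_0"
  shows "sum f A * sum g B * sum h C = (\<Sum>a\<in>A. \<Sum>b\<in>B. \<Sum>c\<in>C. f a * g b * h c)"
  unfolding sum_product[of f A g B]
  by (simp only: sum_distrib_right) (simp only: sum_distrib_left)

section \<open>The exponential of the adjoint action as a polynomial\<close>

text \<open>
  Exponents of a monomial: first those of \<open>x\<^sub>1, \<dots>, x\<^sub>4\<close>, then that of the auxiliary variable \<open>t\<close>. Pairs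
  add componentwise, so the finitely supported functions on them, under convolution, are the
  polynomials in these five variables.
\<close>

type_synonym exps = "(nat \<times> nat \<times> nat \<times> nat) \<times> nat"

definition unit_exp :: "nat \<Rightarrow> nat \<times> nat \<times> nat \<times> nat" where
  "unit_exp k = (of_bool (k = 1), of_bool (k = 2), of_bool (k = 3), of_bool (k = 4))"

text \<open>
  This is \<open>exp(t ad x\<^sub>5) x\<^sub>k\<close>, a finite sum because \<open>ad x\<^sub>5\<close> sends \<open>x\<^sub>k\<close> to \<open>- x\<^bsub>k-1\<^esub>\<close> and kills \<open>x\<^sub>1\<close>.
\<close>

definition exp_ad :: "nat \<Rightarrow> exps \<Rightarrow>\<^sub>0 'f::field_char_0" where
  "exp_ad k = (\<Sum>j<k. Poly_Mapping.single (unit_exp (k - j), j) ((-1) ^ j / fact j))"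

lemma single_power:
  "Poly_Mapping.single ((a, b, c, d), i) (v :: 'f::field_char_0) ^ n
     = Poly_Mapping.single ((n * a, n * b, n * c, n * d), n * i) (v ^ n)"
proof (induction n)
  case 0
  then show ?case by (simp add: flip: zero_prod_def single_one)
next
  case (Suc n)
  then show ?case by (simp add: mult_single)
qed

lemma of_nat_mult_single:
  "of_nat N * Poly_Mapping.single w (v :: 'f::field_char_0) = Poly_Mapping.single (w :: exps) (of_nat N * v)"
  by (simp add: mult_single flip: single_of_nat)

lemma exp_ad_1_power: "exp_ad 1 ^ p = Poly_Mapping.single ((p, 0, 0, 0), 0) 1"
  by (simp add: exp_ad_def unit_exp_def single_power)

lemma exp_ad_2_power:
  "exp_ad 2 ^ q = (\<Sum>\<alpha>\<le>q. Poly_Mapping.single ((\<alpha>, q - \<alpha>, 0, 0), \<alpha>) (of_nat (q choose \<alpha>) * (-1) ^ \<alpha>))"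
proof -
  have "exp_ad 2 = Poly_Mapping.single ((1, 0, 0, 0), 1) (-1) + Poly_Mapping.single ((0, 1, 0, 0), 0) (1 :: 'a)"
    by (simp add: exp_ad_def unit_exp_def numeral_2_eq_2)
  then show ?thesis
    by (simp add: binomial_ring single_power mult_single of_nat_mult_single)
qed

lemma exp_ad_3_power:
  "exp_ad 3 ^ r = (\<Sum>(\<beta>1, \<beta>2)\<in>{(\<beta>1, \<beta>2). \<beta>1 + \<beta>2 \<le> r}.
     Poly_Mapping.single ((\<beta>2, \<beta>1, r - \<beta>1 - \<beta>2, 0), \<beta>1 + 2 * \<beta>2)
       (of_nat (r choose (\<beta>1 + \<beta>2)) * of_nat ((\<beta>1 + \<beta>2) choose \<beta>1) * (-1) ^ \<beta>1 / 2 ^ \<beta>2))"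
proof -
  have "exp_ad 3 = Poly_Mapping.single ((0, 0, 1, 0), 0) 1 + Poly_Mapping.single ((0, 1, 0, 0), 1) (-1)
      + Poly_Mapping.single ((1, 0, 0, 0), 2) (1 / 2 :: 'a)"
    by (simp add: exp_ad_def unit_exp_def eval_nat_numeral)
  then show ?thesis
    by (simp add: trinomial single_power mult_single of_nat_mult_single power_divide mult_ac)
qed

lemma exp_ad_4_power:
  "exp_ad 4 ^ s = (\<Sum>(\<gamma>1, \<gamma>2, \<gamma>3)\<in>{(\<gamma>1, \<gamma>2, \<gamma>3). \<gamma>1 + \<gamma>2 + \<gamma>3 \<le> s}.
     Poly_Mapping.single ((\<gamma>3, \<gamma>2, \<gamma>1, s - \<gamma>1 - \<gamma>2 - \<gamma>3), \<gamma>1 + 2 * \<gamma>2 + 3 * \<gamma>3)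
       (of_nat (s choose (\<gamma>1 + \<gamma>2 + \<gamma>3)) * (fact (\<gamma>1 + \<gamma>2 + \<gamma>3)
          / (fact 2 ^ \<gamma>2 * fact 3 ^ \<gamma>3 * fact \<gamma>3 * fact \<gamma>2 * fact \<gamma>1)) * (-1) ^ (\<gamma>1 + \<gamma>3)))"
proof -
  have E: "exp_ad 4 = Poly_Mapping.single ((0, 0, 0, 1), 0) 1 + Poly_Mapping.single ((0, 0, 1, 0), 1) (-1)
      + Poly_Mapping.single ((0, 1, 0, 0), 2) (1 / fact 2) + Poly_Mapping.single ((1, 0, 0, 0), 3) (- 1 / fact 3 :: 'a)"
    by (simp add: exp_ad_def unit_exp_def eval_nat_numeral)
  have "of_nat ((s choose (i + k + l)) * ((i + k + l) choose i) * ((k + l) choose k))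
       * ((-1) ^ i * (1 / fact 2) ^ k * (- 1 / fact 3) ^ l) =
    of_nat (s choose (i + k + l)) * (fact (i + k + l)
          / (fact 2 ^ k * fact 3 ^ l * fact l * fact k * fact i)) * (-1 :: 'a) ^ (i + l)" for i k l
    unfolding of_nat_mult mult.assoc multinomial_coeff
    by (simp only: mult.assoc[symmetric] of_nat_mult) (simp only: mult.assoc multinomial_coeff
      power_divide power_add power_one times_divide_eq_left times_divide_eq_right divide_divide_eq_left mult_ac mult_1_left mult_1_right)
  then have "of_nat ((s choose (i + k + l)) * ((i + k + l) choose i) * ((k + l) choose k))
       * (Poly_Mapping.single ((0, 0, 0, 1), 0) 1 ^ (s - i - k - l) * Poly_Mapping.single ((0, 0, 1, 0), 1) (-1) ^ i
          * Poly_Mapping.single ((0, 1, 0, 0), 2) (1 / fact 2) ^ k * Poly_Mapping.single ((1, 0, 0, 0), 3) (- 1 / fact 3) ^ l) =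
     Poly_Mapping.single ((l, k, i, s - i - k - l), i + 2 * k + 3 * l)
       (of_nat (s choose (i + k + l)) * (fact (i + k + l)
          / (fact 2 ^ k * fact 3 ^ l * fact l * fact k * fact i)) * (-1 :: 'a) ^ (i + l))" for i k l
    unfolding single_power mult_single of_nat_mult_single
    by (intro arg_cong2[where f = Poly_Mapping.single]) simp_all
  then show ?thesis
    unfolding E quadrinomial by (intro sum.cong) auto
qed

section \<open>Rings modulo a congruence\<close>

text \<open>
  A congruence on a ring stands in for the quotient ring: it lets the computation stay in the ring of
  a type, where the simplifier and the library of finite sums apply, although the quotient of
  interest depends on parameters and is therefore not a type.
\<close>

locale ring_congruence =
  fixes R :: "'a::ring_1 \<Rightarrow> 'a \<Rightarrow> bool" (infix "\<approx>" 50)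
  assumes R_refl [simp, intro]: "a \<approx> a"
    and R_sym: "a \<approx> b \<Longrightarrow> b \<approx> a"
    and R_trans [trans]: "a \<approx> b \<Longrightarrow> b \<approx> c \<Longrightarrow> a \<approx> c"
    and R_add: "a \<approx> b \<Longrightarrow> c \<approx> d \<Longrightarrow> a + c \<approx> b + d"
    and R_mult: "a \<approx> b \<Longrightarrow> c \<approx> d \<Longrightarrow> a * c \<approx> b * d"
begin

lemma R_diff: "a \<approx> b \<Longrightarrow> c \<approx> d \<Longrightarrow> a - c \<approx> b - d"
  using R_add[of a b "-1 * c" "-1 * d"] R_mult[of "-1" "-1" c d] by simp

lemma R_sum: "(\<And>i. i \<in> A \<Longrightarrow> f i \<approx> h i) \<Longrightarrow> sum f A \<approx> sum h A"
  by (induction A rule: infinite_finite_induct) (auto intro: R_add)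

lemma R_commute_power:
  assumes "a * b \<approx> b * a"
  shows "a ^ n * b \<approx> b * a ^ n"
proof (induction n)
  case (Suc n)
  have "a ^ Suc n * b = a * (a ^ n * b)" by (simp add: mult.assoc)
  also have "\<dots> \<approx> a * (b * a ^ n)" by (intro R_mult Suc R_refl)
  also have "\<dots> = a * b * a ^ n" by (simp add: mult.assoc)
  also have "\<dots> \<approx> b * a * a ^ n" by (intro R_mult assms R_refl)
  finally show ?case by (simp add: mult.assoc)
qed simp

text \<open>
  The Leibniz rule for commuting a power of \<open>y\<close> past \<open>a i\<close>, when \<open>ad y\<close> acts on the sequence \<open>a\<close> as the
  negative shift. The induction step moves one \<open>y\<close> past \<open>a i\<close> and recombines the two resulting sums
  with Pascal's rule; since the shift raises the index, the induction runs over all \<open>i\<close> at once.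
\<close>

lemma R_power_chain:
  assumes chain: "\<And>i. y * a i \<approx> a i * y - a (Suc i)"
  shows "y ^ m * a i \<approx> (\<Sum>j\<le>m. of_nat (m choose j) * (-1) ^ j * a (i + j) * y ^ (m - j))"
proof (induction m arbitrary: i)
  case (Suc m)
  define f where "f N j = of_nat (N choose j) * (-1) ^ j * a (i + j) * y ^ (Suc m - j)" for N j
  have "y ^ Suc m * a i = y ^ m * (y * a i)"
    by (simp only: power_Suc2 mult.assoc)
  also have "\<dots> \<approx> y ^ m * (a i * y - a (Suc i))"
    by (intro R_mult chain R_refl)
  also have "\<dots> = y ^ m * a i * y - y ^ m * a (Suc i)"
    by (simp add: algebra_simps)
  also have "\<dots> \<approx> (\<Sum>j\<le>m. of_nat (m choose j) * (-1) ^ j * a (i + j) * y ^ (m - j)) * y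
      - (\<Sum>j\<le>m. of_nat (m choose j) * (-1) ^ j * a (Suc i + j) * y ^ (m - j))"
    by (intro R_diff R_mult Suc R_refl)
  also have "\<dots> = (\<Sum>j\<le>m. f m j) + (\<Sum>j\<le>m. of_nat (m choose j) * (-1) ^ Suc j * a (Suc i + j) * y ^ (m - j))"
    by (simp add: f_def sum_distrib_right mult.assoc Suc_diff_le sum_negf flip: power_Suc2)
  \<comment> \<open>The added term vanishes, and splitting off \<open>j = 0\<close> instead aligns the two sums.\<close>
  also have "(\<Sum>j\<le>m. f m j) = (\<Sum>j\<le>Suc m. f m j)"
    by (simp add: f_def binomial_eq_0)
  also have "\<dots> = f m 0 + (\<Sum>j\<le>m. f m (Suc j))"
    by (rule sum.atMost_Suc_shift)
  also have "f m 0 + (\<Sum>j\<le>m. f m (Suc j))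
        + (\<Sum>j\<le>m. of_nat (m choose j) * (-1) ^ Suc j * a (Suc i + j) * y ^ (m - j))
      = f (Suc m) 0 + (\<Sum>j\<le>m. f (Suc m) (Suc j))"
    unfolding add.assoc sum.distrib[symmetric]
    by (intro arg_cong2[where f = plus] sum.cong refl) (simp_all add: f_def algebra_simps)
  also have "\<dots> = (\<Sum>j\<le>Suc m. f (Suc m) j)"
    by (rule sum.atMost_Suc_shift[symmetric])
  finally show ?case by (simp only: f_def)
qed simp

end

section \<open>Straightening products modulo the relations\<close>

definition n55_coeff :: "nat \<Rightarrow> nat \<Rightarrow> nat \<Rightarrow> nat \<Rightarrow> nat \<Rightarrow> nat \<Rightarrow> nat \<Rightarrow> nat \<Rightarrow> nat \<Rightarrow> nat \<Rightarrow> 'f::field_char_0" where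
  "n55_coeff n q r s \<alpha> \<beta>1 \<beta>2 \<gamma>1 \<gamma>2 \<gamma>3 =
     of_nat (n choose \<alpha>) * of_nat (q choose \<alpha>) * of_nat (r choose (\<beta>1 + \<beta>2))
          * of_nat ((n - \<alpha>) choose (\<beta>1 + 2 * \<beta>2)) * of_nat ((\<beta>1 + \<beta>2) choose \<beta>1)
          * of_nat (s choose (\<gamma>1 + \<gamma>2 + \<gamma>3))
          * of_nat ((n - \<alpha> - \<beta>1 - 2 * \<beta>2) choose (\<gamma>1 + 2 * \<gamma>2 + 3 * \<gamma>3))
          * fact \<alpha> * (fact (\<beta>1 + 2 * \<beta>2) / 2 ^ \<beta>2)
          * (fact (\<gamma>1 + \<gamma>2 + \<gamma>3) * fact (\<gamma>1 + 2 * \<gamma>2 + 3 * \<gamma>3)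
             / (fact 2 ^ \<gamma>2 * fact 3 ^ \<gamma>3 * fact \<gamma>3 * fact \<gamma>2 * fact \<gamma>1))
          * (- 1) ^ (\<alpha> + \<beta>1 + \<gamma>1 + \<gamma>3)"

definition ordered_monom :: "(nat \<Rightarrow> 'a::monoid_mult) \<Rightarrow> nat \<times> nat \<times> nat \<times> nat \<Rightarrow> 'a" where
  "ordered_monom g = (\<lambda>(a, b, c, d). g 1 ^ a * g 2 ^ b * g 3 ^ c * g 4 ^ d)"

locale n55_congruence = ring_congruence R
  for R :: "'a::ring_1 \<Rightarrow> 'a \<Rightarrow> bool" (infix "\<approx>" 50) +
  fixes sc :: "'f::field_char_0 \<Rightarrow> 'a" and g :: "nat \<Rightarrow> 'a" and y :: 'a
  assumes sc_add: "sc (c + d) = sc c + sc d"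
    and sc_mult: "sc (c * d) = sc c * sc d"
    and sc_1 [simp]: "sc 1 = 1"
    and sc_central: "a * sc c = sc c * a"
    and g_commute: "i \<in> {1..4} \<Longrightarrow> j \<in> {1..4} \<Longrightarrow> g i * g j \<approx> g j * g i"
    and y_g_1: "y * g 1 \<approx> g 1 * y"
    and y_g_Suc: "i \<in> {1..3} \<Longrightarrow> y * g (Suc i) \<approx> g (Suc i) * y - g i"
begin

lemma sc_0 [simp]: "sc 0 = 0"
  using sc_add[of 0 0] by simp

lemma sc_neg: "sc (- c) = - sc c"
  using sc_add[of "- c" c] by (simp add: eq_neg_iff_add_eq_0)

lemma sc_of_nat: "sc (of_nat N) = of_nat N"
  by (induction N) (simp_all add: sc_add)

lemma sc_neg_1_power: "sc ((-1) ^ j) = (-1) ^ j"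
  by (induction j) (simp_all add: sc_mult sc_neg)

lemma sc_mult_pull: "sc c * z * (sc d * w) = sc (c * d) * (z * w)"
  by (metis mult.assoc sc_central sc_mult)

text \<open>
  The chain \<open>g k, g (k - 1), \<dots>, g 1\<close>, continued by zeros, satisfies the hypothesis of
  \<open>R_power_chain\<close>; the zeros express that \<open>y\<close> commutes with \<open>g 1\<close>.
\<close>

lemma y_power_g:
  assumes k: "k \<in> {1..4}"
  shows "y ^ m * g k \<approx> (\<Sum>j<k. sc (of_nat (m choose j) * (-1) ^ j) * g (k - j) * y ^ (m - j))"
proof -
  define a where "a j = (if j < k then g (k - j) else 0)" for j
  define f where "f j = sc (of_nat (m choose j) * (-1) ^ j) * a j * y ^ (m - j)" for j
  have "y * a j \<approx> a j * y - a (Suc j)" for j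
  proof -
    consider "Suc j < k" | "Suc j = k" | "k \<le> j" by linarith
    then show ?thesis
    proof cases
      case 1
      then have "k - Suc j \<in> {1..3}" "k - j = Suc (k - Suc j)" using k by auto
      with 1 show ?thesis using y_g_Suc[of "k - Suc j"] by (simp add: a_def)
    qed (use y_g_1 in \<open>auto simp: a_def\<close>)
  qed
  from R_power_chain[of y a m 0, OF this]
  have "y ^ m * a 0 \<approx> (\<Sum>j\<le>m. f j)"
    by (simp add: f_def sc_mult sc_of_nat sc_neg_1_power)
  \<comment> \<open>Terms with \<open>j \<ge> k\<close> vanish by the choice of \<open>a\<close>, those with \<open>j > m\<close> by the binomial coefficient.\<close>
  also have "(\<Sum>j\<le>m. f j) = (\<Sum>j\<in>{..m} \<inter> {..<k}. f j)"
    by (rule sum.mono_neutral_right) (auto simp: f_def a_def)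
  also have "\<dots> = (\<Sum>j<k. f j)"
  proof (rule sum.mono_neutral_left)
    show "\<forall>j\<in>{..<k} - {..m} \<inter> {..<k}. f j = 0"
    proof
      fix j assume "j \<in> {..<k} - {..m} \<inter> {..<k}"
      then have "m < j" by auto
      then show "f j = 0" by (simp add: f_def binomial_eq_0)
    qed
  qed auto
  also have "\<dots> = (\<Sum>j<k. sc (of_nat (m choose j) * (-1) ^ j) * g (k - j) * y ^ (m - j))"
    by (intro sum.cong) (auto simp: f_def a_def)
  finally show ?thesis using k by (simp add: a_def)
qed

lemma ordered_monom_mult_g:
  assumes k: "k \<in> {1..4}"
  shows "ordered_monom g v * g k \<approx> ordered_monom g (v + unit_exp k)"
proof -
  obtain a b c d where v: "v = (a, b, c, d)" by (cases v)
  have c: "g i ^ e * g k \<approx> g k * g i ^ e" if "i \<in> {1..4}" for i e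
    by (intro R_commute_power g_commute k that)
  have move: "z * g i ^ e * g k \<approx> z * g k * g i ^ e" if "i \<in> {1..4}" for z i e
    using R_mult[OF R_refl[of z] c[OF that, of e]] by (simp add: mult.assoc)
  have t4: "ordered_monom g v * g k \<approx> g 1 ^ a * g 2 ^ b * g 3 ^ c * g k * g 4 ^ d"
    unfolding v ordered_monom_def by (simp add: move)
  have "g 1 ^ a * g 2 ^ b * g 3 ^ c * g k * g 4 ^ d \<approx> g 1 ^ a * g 2 ^ b * g k * g 3 ^ c * g 4 ^ d"
    by (intro R_mult move R_refl) auto
  note t3 = R_trans[OF t4 this]
  have "g 1 ^ a * g 2 ^ b * g k * g 3 ^ c * g 4 ^ d \<approx> g 1 ^ a * g k * g 2 ^ b * g 3 ^ c * g 4 ^ d"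
    by (intro R_mult move R_refl) auto
  note t2 = R_trans[OF t3 this]
  consider "k = 1" | "k = 2" | "k = 3" | "k = 4" using k by force
  then show ?thesis
  proof cases
    case 1
    with t2 show ?thesis by (simp add: v ordered_monom_def unit_exp_def mult.assoc power_Suc2 del: power_Suc)
  next
    case 2
    with t3 show ?thesis by (simp add: v ordered_monom_def unit_exp_def mult.assoc power_Suc2 del: power_Suc)
  next
    case 3
    with t4 show ?thesis by (simp add: v ordered_monom_def unit_exp_def mult.assoc power_Suc2 del: power_Suc)
  next
    case 4
    then show ?thesis by (simp add: v ordered_monom_def unit_exp_def mult.assoc power_Suc2 del: power_Suc)
  qed
qed

text \<open>
  The linear map with \<open>x\<^sup>v t\<^sup>i \<mapsto> (n)\<^sub>i x\<^sup>v y\<^bsup>n-i\<^esup>\<close>. For \<open>i > n\<close> the truncated exponent \<open>n - i\<close> is harmless, as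
  the falling factorial is then zero.
\<close>

definition normal_order :: "nat \<Rightarrow> (exps \<Rightarrow>\<^sub>0 'f) \<Rightarrow> 'a" where
  "normal_order n p = (\<Sum>w\<in>Poly_Mapping.keys p.
     sc (Poly_Mapping.lookup p w * falling n (snd w)) * ordered_monom g (fst w) * y ^ (n - snd w))"

lemma normal_order_superset:
  assumes "finite W" "Poly_Mapping.keys p \<subseteq> W"
  shows "normal_order n p = (\<Sum>w\<in>W.
    sc (Poly_Mapping.lookup p w * falling n (snd w)) * ordered_monom g (fst w) * y ^ (n - snd w))"
  unfolding normal_order_def using assms
  by (intro sum.mono_neutral_left) (auto simp: in_keys_iff)

lemma normal_order_add: "normal_order n (p + q) = normal_order n p + normal_order n q"
proof -
  let ?W = "Poly_Mapping.keys p \<union> Poly_Mapping.keys q"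
  have "normal_order n (p + q) = (\<Sum>w\<in>?W.
      sc (Poly_Mapping.lookup (p + q) w * falling n (snd w)) * ordered_monom g (fst w) * y ^ (n - snd w))"
    by (rule normal_order_superset) (use Poly_Mapping.keys_add[of p q] in auto)
  then show ?thesis
    by (simp add: normal_order_superset[of ?W p] normal_order_superset[of ?W q]
        lookup_add sc_add distrib_right sum.distrib)
qed

lemma normal_order_single:
  "normal_order n (Poly_Mapping.single (v, i) c) = sc (c * falling n i) * ordered_monom g v * y ^ (n - i)"
  by (cases "c = 0") (auto simp: normal_order_def)

lemma normal_order_0 [simp]: "normal_order n 0 = 0"
  by (simp add: normal_order_def)

lemma normal_order_sum: "normal_order n (\<Sum>i\<in>A. f i) = (\<Sum>i\<in>A. normal_order n (f i))"
  by (induction A rule: infinite_finite_induct) (simp_all add: normal_order_add)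

text \<open>
  The Leibniz rule in closed form. On a monomial \<open>x\<^sup>v t\<^sup>i\<close>, moving \<open>g k\<close> to the left past \<open>y\<^bsup>n-i\<^esup>\<close> yields the
  coefficients \<open>(n - i choose j) (-1)\<^sup>j = (n - i)\<^sub>j (-1)\<^sup>j/j!\<close>, and \<open>(n)\<^sub>i (n - i)\<^sub>j = (n)\<^bsub>i+j\<^esub>\<close> is exactly the
  factor attached to \<open>t\<^bsup>i+j\<^esup>\<close>. So right multiplication by \<open>g k\<close> becomes a multiplication of
  commutative polynomials, whose powers are accessible to the multinomial theorems.
\<close>

lemma normal_order_mult_g:
  assumes k: "k \<in> {1..4}"
  shows "normal_order n p * g k \<approx> normal_order n (p * exp_ad k)"
proof (induction p rule: poly_mapping_additive_induct)
  case (add p q)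
  then show ?case by (simp add: distrib_right normal_order_add R_add)
next
  case (single w c)
  obtain v i where w: "w = (v, i)" by (cases w)
  have "normal_order n (Poly_Mapping.single w c) * g k = sc (c * falling n i) * ordered_monom g v * (y ^ (n - i) * g k)"
    by (simp add: w normal_order_single mult.assoc)
  also have "\<dots> \<approx> sc (c * falling n i) * ordered_monom g v
      * (\<Sum>j<k. sc (of_nat ((n - i) choose j) * (-1) ^ j) * g (k - j) * y ^ (n - i - j))"
    by (intro R_mult R_refl y_power_g k)
  also have "\<dots> = (\<Sum>j<k. sc (c * falling n i * (of_nat ((n - i) choose j) * (-1) ^ j))
      * (ordered_monom g v * g (k - j)) * y ^ (n - i - j))"
    unfolding sum_distrib_left
    using sc_mult_pull[of _ "ordered_monom g v"] by (simp add: mult.assoc)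
  also have "\<dots> \<approx> (\<Sum>j<k. sc (c * falling n i * (of_nat ((n - i) choose j) * (-1) ^ j))
      * ordered_monom g (v + unit_exp (k - j)) * y ^ (n - i - j))"
    using k by (intro R_sum R_mult R_refl ordered_monom_mult_g) auto
  also have "\<dots> = (\<Sum>j<k. normal_order n (Poly_Mapping.single (v + unit_exp (k - j), i + j) (c * ((-1) ^ j / fact j))))"
    by (intro sum.cong refl) (simp add: normal_order_single falling_add falling_def[of "n - i"] mult_ac diff_diff_left)
  also have "\<dots> = normal_order n (Poly_Mapping.single w c * exp_ad k)"
    by (simp add: w exp_ad_def sum_distrib_left mult_single normal_order_sum)
  finally show ?case .
qed

lemma normal_order_mult_g_power:
  assumes k: "k \<in> {1..4}"
  shows "normal_order n p * g k ^ e \<approx> normal_order n (p * exp_ad k ^ e)"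
proof (induction e)
  case (Suc e)
  have "normal_order n p * g k ^ Suc e = normal_order n p * g k ^ e * g k"
    by (simp only: power_Suc2 mult.assoc)
  also have "\<dots> \<approx> normal_order n (p * exp_ad k ^ e) * g k"
    by (intro R_mult Suc R_refl)
  also have "\<dots> \<approx> normal_order n (p * exp_ad k ^ e * exp_ad k)"
    by (rule normal_order_mult_g[OF k])
  finally show ?case by (simp only: power_Suc2 mult.assoc)
qed simp

lemma ordered_monom_product:
  "ordered_monom g v * y ^ n * ordered_monom g (p, q, r, s) \<approx>
     normal_order n (Poly_Mapping.single (v, 0) 1 * exp_ad 1 ^ p * exp_ad 2 ^ q * exp_ad 3 ^ r * exp_ad 4 ^ s)"
proof -
  have "ordered_monom g v * y ^ n * ordered_monom g (p, q, r, s)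
      = normal_order n (Poly_Mapping.single (v, 0) 1) * g 1 ^ p * g 2 ^ q * g 3 ^ r * g 4 ^ s"
    by (simp add: normal_order_single ordered_monom_def mult.assoc)
  also have "\<dots> \<approx> normal_order n (Poly_Mapping.single (v, 0) 1 * exp_ad 1 ^ p) * g 2 ^ q * g 3 ^ r * g 4 ^ s"
    by (intro R_mult R_refl normal_order_mult_g_power) simp
  also have "\<dots> \<approx> normal_order n (Poly_Mapping.single (v, 0) 1 * exp_ad 1 ^ p * exp_ad 2 ^ q) * g 3 ^ r * g 4 ^ s"
    by (intro R_mult R_refl normal_order_mult_g_power) simp
  also have "\<dots> \<approx> normal_order n (Poly_Mapping.single (v, 0) 1 * exp_ad 1 ^ p * exp_ad 2 ^ q * exp_ad 3 ^ r) * g 4 ^ s"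
    by (intro R_mult R_refl normal_order_mult_g_power) simp
  also have "\<dots> \<approx> normal_order n (Poly_Mapping.single (v, 0) 1 * exp_ad 1 ^ p * exp_ad 2 ^ q * exp_ad 3 ^ r * exp_ad 4 ^ s)"
    by (intro normal_order_mult_g_power) simp
  finally show ?thesis .
qed

text \<open>
  Expanding the commutative powers produces the sum over the full ranges \<open>\<alpha> \<le> q\<close>, \<open>\<beta>\<^sub>1 + \<beta>\<^sub>2 \<le> r\<close>,
  \<open>\<gamma>\<^sub>1 + \<gamma>\<^sub>2 + \<gamma>\<^sub>3 \<le> s\<close>. The falling factorial of the total \<open>t\<close>-degree removes the terms of degree greater
  than \<open>n\<close>, and for the others it factors into the three factorials and binomials of \<open>n55_coeff\<close>.
\<close>

lemma ordered_monom_product_sum: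
  "ordered_monom g (j, k, l, m) * y ^ n * (ordered_monom g (p, q, r, s) * y ^ t) \<approx>
    (\<Sum>\<alpha>\<in>{0..min n q}.
     \<Sum>(\<beta>1, \<beta>2)\<in>{(\<beta>1, \<beta>2). \<beta>1 + \<beta>2 \<le> r \<and> \<beta>1 + 2 * \<beta>2 \<le> n - \<alpha>}.
     \<Sum>(\<gamma>1, \<gamma>2, \<gamma>3)\<in>{(\<gamma>1, \<gamma>2, \<gamma>3). \<gamma>1 + \<gamma>2 + \<gamma>3 \<le> s
        \<and> \<gamma>1 + 2 * \<gamma>2 + 3 * \<gamma>3 \<le> n - \<alpha> - \<beta>1 - 2 * \<beta>2}.
      sc (n55_coeff n q r s \<alpha> \<beta>1 \<beta>2 \<gamma>1 \<gamma>2 \<gamma>3)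
      * (ordered_monom g (j + p + \<alpha> + \<beta>2 + \<gamma>3, k + q - \<alpha> + \<beta>1 + \<gamma>2,
           l + r - \<beta>1 - \<beta>2 + \<gamma>1, m + s - \<gamma>1 - \<gamma>2 - \<gamma>3)
         * y ^ (n + t - \<alpha> - \<beta>1 - 2 * \<beta>2 - \<gamma>1 - 2 * \<gamma>2 - 3 * \<gamma>3)))" (is "_ \<approx> ?rhs")
proof -
  define B where "B = {(\<beta>1, \<beta>2). \<beta>1 + \<beta>2 \<le> r}"
  define C where "C = {(\<gamma>1, \<gamma>2, \<gamma>3). \<gamma>1 + \<gamma>2 + \<gamma>3 \<le> s}"
  have fin: "finite B" "finite C"
    unfolding B_def C_def
    by (rule finite_subset[of _ "{..r} \<times> {..r}"], auto)
       (rule finite_subset[of _ "{..s} \<times> {..s} \<times> {..s}"], auto)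
  define cA where "cA \<alpha> = of_nat (q choose \<alpha>) * (-1 :: 'f) ^ \<alpha>" for \<alpha>
  define cB where "cB \<beta>1 \<beta>2 = of_nat (r choose (\<beta>1 + \<beta>2)) * of_nat ((\<beta>1 + \<beta>2) choose \<beta>1) * (-1 :: 'f) ^ \<beta>1 / 2 ^ \<beta>2"
    for \<beta>1 \<beta>2
  define cC where "cC \<gamma>1 \<gamma>2 \<gamma>3 = of_nat (s choose (\<gamma>1 + \<gamma>2 + \<gamma>3)) * (fact (\<gamma>1 + \<gamma>2 + \<gamma>3)
          / (fact 2 ^ \<gamma>2 * fact 3 ^ \<gamma>3 * fact \<gamma>3 * fact \<gamma>2 * fact \<gamma>1)) * (-1 :: 'f) ^ (\<gamma>1 + \<gamma>3)"
    for \<gamma>1 \<gamma>2 \<gamma>3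
  define F where "F \<alpha> \<beta>1 \<beta>2 \<gamma>1 \<gamma>2 \<gamma>3 =
     sc (cA \<alpha> * cB \<beta>1 \<beta>2 * cC \<gamma>1 \<gamma>2 \<gamma>3
         * falling n (\<alpha> + (\<beta>1 + 2 * \<beta>2) + (\<gamma>1 + 2 * \<gamma>2 + 3 * \<gamma>3)))
     * (ordered_monom g (j + p + \<alpha> + \<beta>2 + \<gamma>3, k + (q - \<alpha>) + \<beta>1 + \<gamma>2, l + (r - \<beta>1 - \<beta>2) + \<gamma>1, m + (s - \<gamma>1 - \<gamma>2 - \<gamma>3))
        * y ^ (n - (\<alpha> + (\<beta>1 + 2 * \<beta>2) + (\<gamma>1 + 2 * \<gamma>2 + 3 * \<gamma>3))) * y ^ t)"
    for \<alpha> \<beta>1 \<beta>2 \<gamma>1 \<gamma>2 \<gamma>3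
  have F_0: "F \<alpha> \<beta>1 \<beta>2 \<gamma>1 \<gamma>2 \<gamma>3 = 0" if "n < \<alpha> + (\<beta>1 + 2 * \<beta>2) + (\<gamma>1 + 2 * \<gamma>2 + 3 * \<gamma>3)" for \<alpha> \<beta>1 \<beta>2 \<gamma>1 \<gamma>2 \<gamma>3
    using that by (simp add: F_def falling_eq_0)
  have expand: "Poly_Mapping.single ((j, k, l, m), 0) 1 * exp_ad 1 ^ p * exp_ad 2 ^ q * exp_ad 3 ^ r * exp_ad 4 ^ s =
    (\<Sum>\<alpha>\<in>{..q}. \<Sum>(\<beta>1, \<beta>2)\<in>B. \<Sum>(\<gamma>1, \<gamma>2, \<gamma>3)\<in>C.
      Poly_Mapping.single
        ((j + p + \<alpha> + \<beta>2 + \<gamma>3, k + (q - \<alpha>) + \<beta>1 + \<gamma>2, l + (r - \<beta>1 - \<beta>2) + \<gamma>1, m + (s - \<gamma>1 - \<gamma>2 - \<gamma>3)),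
         \<alpha> + (\<beta>1 + 2 * \<beta>2) + (\<gamma>1 + 2 * \<gamma>2 + 3 * \<gamma>3))
        (cA \<alpha> * cB \<beta>1 \<beta>2 * cC \<gamma>1 \<gamma>2 \<gamma>3))"
  proof -
    have "Poly_Mapping.single ((j, k, l, m), 0) 1 * exp_ad 1 ^ p * exp_ad 2 ^ q * exp_ad 3 ^ r * exp_ad 4 ^ s
      = Poly_Mapping.single ((j, k, l, m), 0) 1 * exp_ad 1 ^ p * (exp_ad 2 ^ q * exp_ad 3 ^ r * exp_ad 4 ^ s)"
      by (simp only: mult.assoc)
    also have "\<dots> = (\<Sum>\<alpha>\<in>{..q}. \<Sum>\<beta>\<in>B. \<Sum>\<gamma>\<in>C.
       Poly_Mapping.single ((j, k, l, m), 0) 1 * Poly_Mapping.single ((p, 0, 0, 0), 0) 1 *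
       (Poly_Mapping.single ((\<alpha>, q - \<alpha>, 0, 0), \<alpha>) (cA \<alpha>)
        * (case \<beta> of (\<beta>1, \<beta>2) \<Rightarrow> Poly_Mapping.single ((\<beta>2, \<beta>1, r - \<beta>1 - \<beta>2, 0), \<beta>1 + 2 * \<beta>2) (cB \<beta>1 \<beta>2))
        * (case \<gamma> of (\<gamma>1, \<gamma>2, \<gamma>3) \<Rightarrow>
            Poly_Mapping.single ((\<gamma>3, \<gamma>2, \<gamma>1, s - \<gamma>1 - \<gamma>2 - \<gamma>3), \<gamma>1 + 2 * \<gamma>2 + 3 * \<gamma>3) (cC \<gamma>1 \<gamma>2 \<gamma>3))))"
      unfolding exp_ad_1_power exp_ad_2_power exp_ad_3_power exp_ad_4_power B_def[symmetric] C_def[symmetric]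
        cA_def[symmetric] cB_def[symmetric] cC_def[symmetric] sum_product3
      by (simp only: sum_distrib_left)
    finally show ?thesis
      by (simp add: split_def mult_single add.assoc mult.assoc)
  qed
  have "ordered_monom g (j, k, l, m) * y ^ n * (ordered_monom g (p, q, r, s) * y ^ t)
      = ordered_monom g (j, k, l, m) * y ^ n * ordered_monom g (p, q, r, s) * y ^ t"
    by (simp only: mult.assoc)
  also have "\<dots> \<approx> normal_order n (Poly_Mapping.single ((j, k, l, m), 0) 1
      * exp_ad 1 ^ p * exp_ad 2 ^ q * exp_ad 3 ^ r * exp_ad 4 ^ s) * y ^ t"
    by (intro R_mult R_refl ordered_monom_product)
  also have "\<dots> = (\<Sum>\<alpha>\<in>{..q}. \<Sum>(\<beta>1, \<beta>2)\<in>B. \<Sum>(\<gamma>1, \<gamma>2, \<gamma>3)\<in>C. F \<alpha> \<beta>1 \<beta>2 \<gamma>1 \<gamma>2 \<gamma>3)"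
    unfolding expand
    by (simp add: normal_order_sum normal_order_single sum_distrib_right split_def F_def mult.assoc)
  \<comment> \<open>The discarded terms are those of \<open>t\<close>-degree greater than \<open>n\<close>.\<close>
  also have "\<dots> = (\<Sum>\<alpha>\<in>{0..min n q}.
     \<Sum>(\<beta>1, \<beta>2)\<in>{(\<beta>1, \<beta>2). \<beta>1 + \<beta>2 \<le> r \<and> \<beta>1 + 2 * \<beta>2 \<le> n - \<alpha>}.
     \<Sum>(\<gamma>1, \<gamma>2, \<gamma>3)\<in>{(\<gamma>1, \<gamma>2, \<gamma>3). \<gamma>1 + \<gamma>2 + \<gamma>3 \<le> s
        \<and> \<gamma>1 + 2 * \<gamma>2 + 3 * \<gamma>3 \<le> n - \<alpha> - \<beta>1 - 2 * \<beta>2}. F \<alpha> \<beta>1 \<beta>2 \<gamma>1 \<gamma>2 \<gamma>3)"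
  proof (rule sum.mono_neutral_cong_right)
    fix \<alpha> assume \<alpha>: "\<alpha> \<in> {0..min n q}"
    show "(\<Sum>(\<beta>1, \<beta>2)\<in>B. \<Sum>(\<gamma>1, \<gamma>2, \<gamma>3)\<in>C. F \<alpha> \<beta>1 \<beta>2 \<gamma>1 \<gamma>2 \<gamma>3) =
      (\<Sum>(\<beta>1, \<beta>2)\<in>{(\<beta>1, \<beta>2). \<beta>1 + \<beta>2 \<le> r \<and> \<beta>1 + 2 * \<beta>2 \<le> n - \<alpha>}.
       \<Sum>(\<gamma>1, \<gamma>2, \<gamma>3)\<in>{(\<gamma>1, \<gamma>2, \<gamma>3). \<gamma>1 + \<gamma>2 + \<gamma>3 \<le> s
        \<and> \<gamma>1 + 2 * \<gamma>2 + 3 * \<gamma>3 \<le> n - \<alpha> - \<beta>1 - 2 * \<beta>2}. F \<alpha> \<beta>1 \<beta>2 \<gamma>1 \<gamma>2 \<gamma>3)"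
    proof (rule sum.mono_neutral_cong_right[OF fin(1)], safe)
      fix \<beta>1 \<beta>2 assume \<beta>: "\<beta>1 + 2 * \<beta>2 \<le> n - \<alpha>"
      show "(\<Sum>(\<gamma>1, \<gamma>2, \<gamma>3)\<in>C. F \<alpha> \<beta>1 \<beta>2 \<gamma>1 \<gamma>2 \<gamma>3) =
        (\<Sum>(\<gamma>1, \<gamma>2, \<gamma>3)\<in>{(\<gamma>1, \<gamma>2, \<gamma>3). \<gamma>1 + \<gamma>2 + \<gamma>3 \<le> s
          \<and> \<gamma>1 + 2 * \<gamma>2 + 3 * \<gamma>3 \<le> n - \<alpha> - \<beta>1 - 2 * \<beta>2}. F \<alpha> \<beta>1 \<beta>2 \<gamma>1 \<gamma>2 \<gamma>3)"
        by (rule sum.mono_neutral_right[OF fin(2)]) (use \<alpha> \<beta> in \<open>auto simp: C_def intro!: F_0\<close>)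
    qed (use \<alpha> in \<open>auto simp: B_def C_def intro!: sum.neutral F_0\<close>)
  qed (auto intro!: sum.neutral F_0)
  also have "\<dots> = ?rhs"
  proof (intro sum.cong refl, clarify, intro sum.cong refl, clarify)
    fix \<alpha> \<beta>1 \<beta>2 \<gamma>1 \<gamma>2 \<gamma>3
    assume le: "\<alpha> \<in> {0..min n q}" "\<beta>1 + \<beta>2 \<le> r" "\<beta>1 + 2 * \<beta>2 \<le> n - \<alpha>" "\<gamma>1 + \<gamma>2 + \<gamma>3 \<le> s"
      "\<gamma>1 + 2 * \<gamma>2 + 3 * \<gamma>3 \<le> n - \<alpha> - \<beta>1 - 2 * \<beta>2"
    have coeff: "cA \<alpha> * cB \<beta>1 \<beta>2 * cC \<gamma>1 \<gamma>2 \<gamma>3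
          * falling n (\<alpha> + (\<beta>1 + 2 * \<beta>2) + (\<gamma>1 + 2 * \<gamma>2 + 3 * \<gamma>3)) =
        n55_coeff n q r s \<alpha> \<beta>1 \<beta>2 \<gamma>1 \<gamma>2 \<gamma>3"
    proof -
      have "falling n (\<alpha> + (\<beta>1 + 2 * \<beta>2) + (\<gamma>1 + 2 * \<gamma>2 + 3 * \<gamma>3)) =
          (falling n \<alpha> * falling (n - \<alpha>) (\<beta>1 + 2 * \<beta>2)
           * falling (n - \<alpha> - \<beta>1 - 2 * \<beta>2) (\<gamma>1 + 2 * \<gamma>2 + 3 * \<gamma>3) :: 'f)"
        unfolding falling_add[of n "\<alpha> + (\<beta>1 + 2 * \<beta>2)"] falling_add[of n \<alpha>]
        by (simp only: diff_diff_left add.assoc)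
      then show ?thesis
        by (simp only: n55_coeff_def cA_def cB_def cC_def falling_def power_add
          times_divide_eq_left times_divide_eq_right divide_divide_eq_left mult_ac)
    qed
    \<comment> \<open>Here truncated subtraction matters: the bounds \<open>le\<close> keep every difference nonnegative.\<close>
    have y_exp: "y ^ (n - (\<alpha> + (\<beta>1 + 2 * \<beta>2) + (\<gamma>1 + 2 * \<gamma>2 + 3 * \<gamma>3))) * y ^ t =
      y ^ (n + t - \<alpha> - \<beta>1 - 2 * \<beta>2 - \<gamma>1 - 2 * \<gamma>2 - 3 * \<gamma>3)"
      using le unfolding power_add[symmetric] by (intro arg_cong[where f = "power y"]) auto
    have exps: "k + (q - \<alpha>) = k + q - \<alpha>" "l + (r - \<beta>1 - \<beta>2) = l + r - \<beta>1 - \<beta>2"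
        "m + (s - \<gamma>1 - \<gamma>2 - \<gamma>3) = m + s - \<gamma>1 - \<gamma>2 - \<gamma>3"
      using le by auto
    show "F \<alpha> \<beta>1 \<beta>2 \<gamma>1 \<gamma>2 \<gamma>3 = sc (n55_coeff n q r s \<alpha> \<beta>1 \<beta>2 \<gamma>1 \<gamma>2 \<gamma>3)
      * (ordered_monom g (j + p + \<alpha> + \<beta>2 + \<gamma>3, k + q - \<alpha> + \<beta>1 + \<gamma>2,
           l + r - \<beta>1 - \<beta>2 + \<gamma>1, m + s - \<gamma>1 - \<gamma>2 - \<gamma>3)
         * y ^ (n + t - \<alpha> - \<beta>1 - 2 * \<beta>2 - \<gamma>1 - 2 * \<gamma>2 - 3 * \<gamma>3))"
      unfolding F_def coeff mult.assoc[of "ordered_monom g _"] y_exp exps ..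
  qed
  finally show ?thesis .
qed

end

section \<open>The enveloping algebra\<close>

lemma free_scalar_add: "free_scalar (c + d) = free_scalar c + free_scalar d"
  by (simp add: free_scalar_def single_add)

lemma free_scalar_0: "free_scalar 0 = 0"
  by (simp add: free_scalar_def)

lemma free_scalar_mult: "free_scalar (c * d) = free_scalar c * free_scalar d"
  by (simp add: free_scalar_def mult_single plus_list_def)

lemma free_scalar_1: "free_scalar 1 = 1"
  by (simp add: free_scalar_def zero_list_def flip: single_one)

lemma free_scalar_central: "p * free_scalar c = free_scalar c * p"
proof (induction p rule: poly_mapping_additive_induct)
  case (single w d)
  then show ?case by (simp add: free_scalar_def mult_single plus_list_def mult.commute)
qed (simp add: distrib_left distrib_right)

lemma uea_proj_power:
  "uea_proj scale bracket p [^]\<^bsub>uea scale bracket\<^esub> (n::nat) = uea_proj scale bracket (p ^ n)"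
proof (induction n)
  case 0
  then show ?case by (simp add: nat_pow_def uea_proj_hom)
next
  case (Suc n)
  interpret U: ring "uea scale bracket" by (rule uea_ring)
  show ?case by (simp add: Suc uea_proj_hom power_Suc2 del: power_Suc)
qed

lemma uea_finsum_proj:
  assumes "finite A" "\<And>a. a \<in> A \<Longrightarrow> f a = uea_proj scale bracket (h a)"
  shows "finsum (uea scale bracket) f A = uea_proj scale bracket (sum h A)"
proof -
  interpret U: ring "uea scale bracket" by (rule uea_ring)
  have zero: "uea_proj scale bracket 0 = \<zero>\<^bsub>uea scale bracket\<^esub>"
    using uea_proj_hom(1)[of scale bracket 0 0] by (metis U.add.l_cancel_one' U.add.m_closed add_0 rangeI uea_carrier)
  have "finsum (uea scale bracket) (\<lambda>a. uea_proj scale bracket (h a)) A = uea_proj scale bracket (sum h A)"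
    using assms(1)
  proof (induction A rule: finite_induct)
    case (insert a A)
    then show ?case
      by (subst U.finsum_insert) (auto simp: uea_carrier uea_proj_hom)
  qed (simp add: zero)
  moreover have "finsum (uea scale bracket) f A = finsum (uea scale bracket) (\<lambda>a. uea_proj scale bracket (h a)) A"
    by (rule U.finsum_cong') (auto simp: assms uea_carrier)
  ultimately show ?thesis by simp
qed

lemma uea_proj_bracket:
  "uea_proj scale bracket (free_gen a * free_gen b)
    = uea_proj scale bracket (free_gen b * free_gen a + free_gen (bracket a b))"
proof -
  have "uea_proj scale bracket (free_gen b * free_gen a + free_gen (bracket a b))
      = uea_proj scale bracket (free_gen a * free_gen b)"
    unfolding uea_proj_eq_iff
  proof (rule uea_relations_ideal)
    have "free_gen (bracket a b) - (free_gen a * free_gen b - free_gen b * free_gen a) \<in> uea_relations scale bracket"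
      unfolding uea_relations_def by blast
    then show "free_gen b * free_gen a + free_gen (bracket a b) - free_gen a * free_gen b \<in> uea_relations scale bracket"
      by (simp add: algebra_simps)
  qed
  then show ?thesis ..
qed

lemma uea_proj_scale:
  "uea_proj scale bracket (free_gen (scale c a)) = uea_proj scale bracket (free_scalar c * free_gen a)"
  using uea_incl_scale[of scale bracket c a] by (simp add: uea_incl_def uea_proj_hom)

text \<open>
  The generators of the free algebra satisfy the commutation relations of \<open>n55_congruence\<close> modulo the
  defining ideal. The linearity relations of the ideal are needed besides the bracket relation: they
  identify the generators named \<open>0\<close> and \<open>- x i\<close> with zero and with the negative of the one named \<open>x i\<close>.
\<close>

lemma lie_n55_congruence:
  fixes scale :: "'f::field_char_0 \<Rightarrow> 'l::ab_group_add \<Rightarrow> 'l"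
  assumes "lie_n55 scale bracket x"
  shows "n55_congruence (\<lambda>p q. uea_proj scale bracket p = uea_proj scale bracket q)
     free_scalar (\<lambda>i. free_gen (x i)) (free_gen (x 5))"
proof -
  interpret L: lie_n55 scale bracket x by fact
  let ?pr = "uea_proj scale bracket"
  interpret ring_congruence "\<lambda>p q. ?pr p = ?pr q"
  proof
    fix a b c d assume eq: "?pr a = ?pr b" "?pr c = ?pr d"
    show "?pr (a + c) = ?pr (b + d)"
      using eq by (metis uea_proj_hom(1))
    show "?pr (a * c) = ?pr (b * d)"
      using eq by (metis uea_proj_hom(2))
  qed auto
  have gen_0: "?pr (free_gen 0) = ?pr 0"
    using uea_proj_scale[of scale bracket 0 0] by (simp only: L.scale_zero_left free_scalar_def single_zero mult_zero_left)
  have gen_neg: "?pr (free_gen (- a)) = ?pr (- free_gen a)" for a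
  proof -
    have "free_scalar (-1) = (-1 :: 'l list \<Rightarrow>\<^sub>0 'f)"
      using free_scalar_add[of "-1" 1]
      unfolding add.left_inverse free_scalar_0 free_scalar_1 by (metis eq_neg_iff_add_eq_0)
    then show ?thesis
      using uea_proj_scale[of scale bracket "-1" a]
      by (simp only: L.scale_minus_left L.scale_one mult_minus_left mult_1_left)
  qed
  have commute: "?pr (free_gen (x i) * free_gen (x j)) = ?pr (free_gen (x j) * free_gen (x i))"
    if "bracket (x i) (x j) = 0" for i j
    using R_add[OF refl gen_0, of "free_gen (x j) * free_gen (x i)"]
    by (simp only: uea_proj_bracket[of scale bracket "x i"] that add_0_right)
  show ?thesis
  proof
    fix i :: nat assume i: "i \<in> {1..3}"
    have "i = 1 \<or> i = 2 \<or> i = 3" using i by auto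
    then have "bracket (x 5) (x (Suc i)) = - x i"
      using L.bracket_5_2 L.bracket_5_3 L.bracket_5_4 by (auto simp: numeral_eq_Suc)
    then show "?pr (free_gen (x 5) * free_gen (x (Suc i))) = ?pr (free_gen (x (Suc i)) * free_gen (x 5) - free_gen (x i))"
      using R_add[OF refl gen_neg, of "free_gen (x (Suc i)) * free_gen (x 5)" "x i"]
      by (simp only: uea_proj_bracket[of scale bracket "x 5"] add_uminus_conv_diff)
  next
    fix i j :: nat assume "i \<in> {1..4}" "j \<in> {1..4}"
    then show "?pr (free_gen (x i) * free_gen (x j)) = ?pr (free_gen (x j) * free_gen (x i))"
      by (intro commute L.bracket_other) (auto simp: doubleton_eq_iff)
  next
    show "?pr (free_gen (x 5) * free_gen (x 1)) = ?pr (free_gen (x 1) * free_gen (x 5))"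
      by (intro commute L.bracket_other) (auto simp: doubleton_eq_iff)
  qed (rule free_scalar_add free_scalar_mult free_scalar_1 free_scalar_central)+
qed

theorem theorem4p12:
  fixes scale :: "'f::real_normed_field \<Rightarrow> 'l::ab_group_add \<Rightarrow> 'l"
    and bracket :: "'l \<Rightarrow> 'l \<Rightarrow> 'l"
    and x :: "nat \<Rightarrow> 'l"
    and U (structure)
    and u :: "nat \<Rightarrow> ('l list \<Rightarrow>\<^sub>0 'f) set"
    and j k l m n p q r s t :: nat
  assumes n55: "lie_n55 scale bracket x"
    and U_def: "U = uea scale bracket"
    and u_def: "u = (\<lambda>i. uea_incl scale bracket (x i))"
  shows
    "(u 1 [^] j \<otimes> u 2 [^] k \<otimes> u 3 [^] l \<otimes> u 4 [^] m \<otimes> u 5 [^] n) \<otimes>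
     (u 1 [^] p \<otimes> u 2 [^] q \<otimes> u 3 [^] r \<otimes> u 4 [^] s \<otimes> u 5 [^] t) =
     finsum U (\<lambda>\<alpha>. finsum U (\<lambda>(\<beta>1, \<beta>2). finsum U (\<lambda>(\<gamma>1, \<gamma>2, \<gamma>3).
         (of_nat (n choose \<alpha>) * of_nat (q choose \<alpha>) * of_nat (r choose (\<beta>1 + \<beta>2))
          * of_nat ((n - \<alpha>) choose (\<beta>1 + 2 * \<beta>2)) * of_nat ((\<beta>1 + \<beta>2) choose \<beta>1)
          * of_nat (s choose (\<gamma>1 + \<gamma>2 + \<gamma>3))
          * of_nat ((n - \<alpha> - \<beta>1 - 2 * \<beta>2) choose (\<gamma>1 + 2 * \<gamma>2 + 3 * \<gamma>3))
          * fact \<alpha> * (fact (\<beta>1 + 2 * \<beta>2) / 2 ^ \<beta>2)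
          * (fact (\<gamma>1 + \<gamma>2 + \<gamma>3) * fact (\<gamma>1 + 2 * \<gamma>2 + 3 * \<gamma>3)
             / (fact 2 ^ \<gamma>2 * fact 3 ^ \<gamma>3 * fact \<gamma>3 * fact \<gamma>2 * fact \<gamma>1))
          * (- 1) ^ (\<alpha> + \<beta>1 + \<gamma>1 + \<gamma>3))
         \<odot> (u 1 [^] (j + p + \<alpha> + \<beta>2 + \<gamma>3)
             \<otimes> u 2 [^] (k + q - \<alpha> + \<beta>1 + \<gamma>2)
             \<otimes> u 3 [^] (l + r - \<beta>1 - \<beta>2 + \<gamma>1)
             \<otimes> u 4 [^] (m + s - \<gamma>1 - \<gamma>2 - \<gamma>3)
             \<otimes> u 5 [^] (n + t - \<alpha> - \<beta>1 - 2 * \<beta>2 - \<gamma>1 - 2 * \<gamma>2 - 3 * \<gamma>3)))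
         {(\<gamma>1, \<gamma>2, \<gamma>3). \<gamma>1 + \<gamma>2 + \<gamma>3 \<le> s \<and> \<gamma>1 + 2 * \<gamma>2 + 3 * \<gamma>3 \<le> n - \<alpha> - \<beta>1 - 2 * \<beta>2})
         {(\<beta>1, \<beta>2). \<beta>1 + \<beta>2 \<le> r \<and> \<beta>1 + 2 * \<beta>2 \<le> n - \<alpha>})
         {0..min n q}"
proof -
  let ?pr = "uea_proj scale bracket"
  define g where "g i = (free_gen (x i) :: 'l list \<Rightarrow>\<^sub>0 'f)" for i
  define y where "y = (free_gen (x 5) :: 'l list \<Rightarrow>\<^sub>0 'f)"
  interpret n55_congruence "\<lambda>p q. ?pr p = ?pr q" free_scalar g y
    unfolding g_def y_def by (rule lie_n55_congruence[OF n55])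
  have power: "u i [^] (e::nat) = ?pr (g i ^ e)" for i e
    unfolding u_def U_def uea_incl_def uea_proj_power g_def ..
  have y: "g 5 = y" by (simp add: g_def y_def)
  have mult: "?pr a \<otimes> ?pr b = ?pr (a * b)" and smult: "c \<odot> ?pr a = ?pr (free_scalar c * a)" for a b c
    unfolding U_def by (rule uea_proj_hom)+
  have fin1: "finite {(\<beta>1, \<beta>2). \<beta>1 + \<beta>2 \<le> r \<and> \<beta>1 + 2 * \<beta>2 \<le> N}" for N
    by (rule finite_subset[of _ "{..r} \<times> {..r}"]) auto
  have fin2: "finite {(\<gamma>1, \<gamma>2, \<gamma>3). \<gamma>1 + \<gamma>2 + \<gamma>3 \<le> s \<and> \<gamma>1 + 2 * \<gamma>2 + 3 * \<gamma>3 \<le> N}" for N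
    by (rule finite_subset[of _ "{..s} \<times> {..s} \<times> {..s}"]) auto
  note prod = ordered_monom_product_sum[of j k l m n p q r s t, unfolded ordered_monom_def prod.case n55_coeff_def]
  note finsum_proj = uea_finsum_proj[of _ _ scale bracket, folded U_def]
  show ?thesis
    unfolding power y mult smult prod
    by (rule sym, (rule finsum_proj fin1 fin2 finite_atLeastAtMost refl | clarify | simp only: prod.case)+)
qed

end
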